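(* As power series in $q$, $$\sum_{n=0}^{\infty}\sigma_{ed}\mathrm{moex}(n)\,q^n=\frac{(q^2;q^2)^2_{\infty}\,(q;q)^3_{\infty}}{(q^4;q^4)_{\infty}}$$ and $$\sum_{n=0}^{\infty}\sigma_{ed}\mathrm{meex}(n)\,q^n=2\,\frac{(-q^2;q^2)_{\infty}}{(q;q^2)_{\infty}}\,\sigma(q^2),$$ where $\sigma(q):=\sum_{n=0}^{\infty}\frac{q^{n(n+1)/2}}{(-q;q)_n}$.
   Context: Notation: $(a;q)_0:=1$, $(a;q)_n:=\prod_{k=0}^{n-1}(1-aq^k)$, $(a;q)_\infty:=\lim_{n\to\infty}(a;q)_n$. For $n\ge 0$, $\mathcal{P}_{ed}(n)$ is the set of all partitions of $n$ in which no even part is repeated (each even part appears at most once; odd parts may appear with any multiplicity). The empty partition is the unique element of $\mathcal{P}_{ed}(0)$. For $\lambda\in\mathcal{P}_{ed}(n)$, $\mathrm{moex}_{ed}(\lambda)$ (resp. $\mathrm{meex}_{ed}(\lambda)$) is the smallest positive odd (resp. positive even) integer that is not a part of $\lambda$. Define $$\sigma_{ed}\mathrm{moex}(n):=\sum_{\lambda\in\mathcal{P}_{ed}(n)}\mathrm{moex}_{ed}(\lambda),\qquad \sigma_{ed}\mathrm{meex}(n):=\sum_{\lambda\in\mathcal{P}_{ed}(n)}\mathrm{meex}_{ed}(\lambda).$$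
   Formalization: In the first identity the factor (q;q)^3_∞ is replaced by (-q;q)^3_∞: as displayed the identity is false, since the coefficient of q is 3 on the left (the partition {1} has moex 3) but -3 on the right. *)

theory Defs
  imports
    "HOL-Computational_Algebra.Formal_Power_Series"
    "HOL-Library.Multiset"
begin

definition qpoch :: "'a::comm_ring_1 \<Rightarrow> 'a \<Rightarrow> nat \<Rightarrow> 'a" where
  "qpoch a q n = (\<Prod>k<n. 1 - a * q ^ k)"

text \<open>Limits and infinite sums of formal power series are taken in the library's metric on
  \<^typ>\<open>'a fps\<close>, i.e. coefficientwise stabilisation.\<close>

definition qpoch_inf :: "'a::comm_ring_1 fps \<Rightarrow> 'a fps \<Rightarrow> 'a fps" where
  "qpoch_inf a q = lim (\<lambda>n. qpoch a q n)"

definition sigma_series :: "'a::field fps \<Rightarrow> 'a fps" where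
  "sigma_series q = (\<Sum>n. q ^ (n * (n + 1) div 2) / qpoch (- q) q n)"

definition partitions :: "nat \<Rightarrow> nat multiset set" where
  "partitions n = {M. 0 \<notin># M \<and> sum_mset M = n}"

definition P_ed :: "nat \<Rightarrow> nat multiset set" where
  "P_ed n = {M \<in> partitions n. \<forall>k. even k \<longrightarrow> count M k \<le> 1}"

definition moex :: "nat multiset \<Rightarrow> nat" where
  "moex M = (LEAST k. odd k \<and> k \<notin># M)"

definition meex :: "nat multiset \<Rightarrow> nat" where
  "meex M = (LEAST k. 0 < k \<and> even k \<and> k \<notin># M)"

definition sigma_ed_moex :: "nat \<Rightarrow> nat" where
  "sigma_ed_moex n = (\<Sum>M \<in> P_ed n. moex M)"

definition sigma_ed_meex :: "nat \<Rightarrow> nat" where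
  "sigma_ed_meex n = (\<Sum>M \<in> P_ed n. meex M)"

lemma finite_partitions: "finite (partitions n)"
proof -
  have "partitions n \<subseteq> mset ` {xs. set xs \<subseteq> {..n} \<and> length xs \<le> n}"
  proof
    fix M assume "M \<in> partitions n"
    then have M: "0 \<notin># M" "sum_mset M = n"
      by (auto simp: partitions_def)
    obtain xs where xs: "M = mset xs"
      using ex_mset by metis
    have pos: "0 \<notin> set xs" and sum: "sum_list xs = n"
      using M by (simp_all add: xs sum_mset_sum_list)
    have "length ys \<le> sum_list ys" if "0 \<notin> set ys" for ys :: "nat list"
      using that by (induction ys) auto
    then have "length xs \<le> n"
      using pos sum by blast
    moreover have "set xs \<subseteq> {..n}"
      using member_le_sum_list sum by fastforce
    ultimately show "M \<in> mset ` {xs. set xs \<subseteq> {..n} \<and> length xs \<le> n}"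
      using xs by blast
  qed
  then show ?thesis
    by (rule finite_subset) (intro finite_imageI finite_lists_length_le; simp)
qed

lemma finite_P_ed: "finite (P_ed n)"
  by (rule finite_subset[OF _ finite_partitions[of n]]) (auto simp: P_ed_def)

text \<open>The product formula for the generating function of \<^const>\<open>sigma_ed_moex\<close> must contain
  \<open>(-q;q)\<^sup>3\<close>: with \<open>(q;q)\<^sup>3\<close> in its place, which is how the source displays it, the
  coefficient of \<open>q\<close> would be \<open>-3\<close>, whereas \<^term>\<open>sigma_ed_moex 1\<close> is \<open>3\<close>. Indeed
  \<^term>\<open>moex M\<close> is one plus twice the number of \<open>k \<ge> 1\<close> such that \<open>1, 3, ..., 2k - 1\<close> are all
  parts of \<open>M\<close>, so the generating function is \<open>(-q\<^sup>2;q\<^sup>2) / (q;q\<^sup>2)\<close> times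
  \<open>\<Sum>k\<in>\<int>. q ^ k\<^sup>2\<close>; by the triple product identity this is
  \<open>(q\<^sup>2;q\<^sup>2)\<^sup>2 (-q;q)\<^sup>3 / (q\<^sup>4;q\<^sup>4)\<close>, all products being infinite.\<close>

end

theory Submission
  imports Defs
begin

text \<open>
  For a partition \<open>M\<close>, \<open>moex M\<close> is \<open>1\<close> plus twice, and \<open>meex M\<close> is \<open>2\<close> plus twice, the number of
  \<open>k \<ge> 1\<close> such that the first \<open>k\<close> odd (resp. even) numbers all are parts of \<open>M\<close>. The partitions in
  \<open>P_ed\<close> satisfying this condition for a given \<open>k\<close> have the generating function
  \<open>q ^ k\<^sup>2 (-q\<^sup>2;q\<^sup>2) / (q;q\<^sup>2)\<close> (resp. \<open>q ^ (k (k + 1)) (-q\<^sup>2;q\<^sup>2) / ((q;q\<^sup>2) (-q\<^sup>2;q\<^sup>2)\<^sub>k)\<close>).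
  Summing over \<open>k\<close> gives the second formula at once. For the first one, \<open>1 + 2 \<Sum>k\<ge>1. q ^ k\<^sup>2\<close> equals
  \<open>(-q;q\<^sup>2)\<^sup>2 (q\<^sup>2;q\<^sup>2)\<close>, the limit of the \<open>q\<close>-binomial theorem with exponent \<open>2n\<close>, centred at its
  middle term; Euler's identity \<open>(-q;q) (q;q\<^sup>2) = 1\<close> then simplifies the product.
\<close>

unbundle fps_syntax

section \<open>Congruence of power series modulo powers of the variable\<close>

text \<open>Divisibility makes compatibility with products immediate, while the coefficient form
  \<open>fps_cong_iff_nth\<close> settles the rest. Limits below are reduced to such congruences at
  every precision \<open>n\<close>.\<close>

definition fps_cong :: "nat \<Rightarrow> 'a::comm_ring_1 fps \<Rightarrow> 'a fps \<Rightarrow> bool" where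
  "fps_cong n f g \<longleftrightarrow> fps_X ^ n dvd f - g"

lemma fps_X_power_dvd_iff:
  fixes f :: "'a::comm_ring_1 fps"
  shows "fps_X ^ n dvd f \<longleftrightarrow> (\<forall>i<n. f $ i = 0)"
proof
  assume "fps_X ^ n dvd f"
  then show "\<forall>i<n. f $ i = 0"
    by (auto simp: dvd_def fps_X_power_mult_nth)
next
  assume "\<forall>i<n. f $ i = 0"
  then have "f = fps_X ^ n * fps_shift n f"
    by (auto simp: fps_eq_iff fps_X_power_mult_nth)
  then show "fps_X ^ n dvd f"
    by (metis dvd_triv_left)
qed

lemma fps_cong_iff_nth: "fps_cong n f g \<longleftrightarrow> (\<forall>i<n. f $ i = g $ i)"
  by (simp add: fps_cong_def fps_X_power_dvd_iff)

lemma fps_cong_refl [simp, intro]: "fps_cong n f f"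
  by (simp add: fps_cong_iff_nth)

lemma fps_cong_sym: "fps_cong n f g \<Longrightarrow> fps_cong n g f"
  by (simp add: fps_cong_iff_nth)

lemma fps_cong_trans [trans]: "fps_cong n f g \<Longrightarrow> fps_cong n g h \<Longrightarrow> fps_cong n f h"
  by (simp add: fps_cong_iff_nth)

lemma fps_cong_mono: "fps_cong n f g \<Longrightarrow> m \<le> n \<Longrightarrow> fps_cong m f g"
  by (simp add: fps_cong_iff_nth)

lemma fps_cong_mult:
  assumes "fps_cong n f g" "fps_cong n f' g'"
  shows "fps_cong n (f * f') (g * g')"
proof -
  have "f * f' - g * g' = f * (f' - g') + (f - g) * g'"
    by (simp add: algebra_simps)
  then show ?thesis
    using assms unfolding fps_cong_def by (metis dvd_add dvd_mult dvd_mult2)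
qed

lemma fps_cong_power: "fps_cong n f g \<Longrightarrow> fps_cong n (f ^ k) (g ^ k)"
  by (induction k) (auto intro: fps_cong_mult)

lemma fps_cong_sum:
  "(\<And>x. x \<in> A \<Longrightarrow> fps_cong n (f x) (g x)) \<Longrightarrow> fps_cong n (sum f A) (sum g A)"
  by (simp add: fps_cong_iff_nth fps_sum_nth)

lemma fps_cong_X_power_mult:
  "fps_cong n f g \<Longrightarrow> fps_cong (m + n) (fps_X ^ m * f) (fps_X ^ m * g)"
  by (auto simp: fps_cong_def power_add right_diff_distrib[symmetric] intro: mult_dvd_mono)

text \<open>Over a field, a nonzero constant coefficient makes \<open>u\<close> a unit, so the
  congruence can be multiplied by \<open>inverse u\<close>.\<close>

lemma fps_cong_unit_cancel:
  fixes u :: "'a::field fps"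
  assumes "fps_cong n (u * f) (u * g)" "u $ 0 \<noteq> 0"
  shows "fps_cong n f g"
proof -
  have "fps_cong n (inverse u * (u * f)) (inverse u * (u * g))"
    by (intro fps_cong_mult assms) auto
  then show ?thesis
    using assms(2) by (simp add: mult.assoc[symmetric] inverse_mult_eq_1)
qed

lemma fps_eq_if_cong:
  assumes "\<And>n. fps_cong n f g"
  shows "f = g"
  using assms by (auto simp: fps_cong_iff_nth fps_eq_iff)

text \<open>The index of the sequence doubles as the precision: coefficient \<open>i\<close> is
  constant from index \<open>Suc i\<close> on.\<close>

lemma fps_LIMSEQ_if_cong:
  fixes f :: "nat \<Rightarrow> 'a::comm_ring_1 fps"
  assumes "\<And>n. fps_cong n (f n) g"
  shows "f \<longlonglongrightarrow> g"
proof (rule tendsto_fpsI)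
  fix i
  have "f n $ i = g $ i" if "n \<ge> Suc i" for n
    using assms[of n] that by (auto simp: fps_cong_iff_nth)
  then show "\<forall>\<^sub>F n in sequentially. f n $ i = g $ i"
    unfolding eventually_sequentially by blast
qed

section \<open>Infinite products\<close>

lemma qpoch_Suc: "qpoch a q (Suc n) = qpoch a q n * (1 - a * q ^ n)"
  by (simp add: qpoch_def)

text \<open>Every factor of index at least \<open>n\<close> is 1 modulo \<open>fps_X ^ e\<close>,
  because \<open>a * q ^ n\<close> divides \<open>a * q ^ m\<close> for
  \<open>m \<ge> n\<close>.\<close>

lemma fps_cong_qpoch:
  fixes a q :: "'a::comm_ring_1 fps"
  assumes "fps_X ^ e dvd a * q ^ n" "n \<le> m"
  shows "fps_cong e (qpoch a q m) (qpoch a q n)"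
  using assms(2)
proof (induction m rule: dec_induct)
  case (step m)
  have "fps_X ^ e dvd a * q ^ m"
    using assms(1) step.hyps(1) by (metis dvd_mult2 le_add_diff_inverse mult.assoc power_add)
  then have "fps_X ^ e dvd - qpoch a q m * (a * q ^ m)"
    by (rule dvd_mult)
  then have "fps_cong e (qpoch a q (Suc m)) (qpoch a q m)"
    by (simp add: fps_cong_def qpoch_Suc algebra_simps)
  then show ?case
    using step.IH fps_cong_trans by blast
qed auto

text \<open>The precision \<open>e\<close> is kept apart from the number \<open>n\<close> of
  factors, since for Gaussian binomials in base \<open>q^2\<close> the precision grows twice as fast
  as the number of factors.\<close>

lemma fps_cong_qpoch_inf:
  fixes a q :: "'a::comm_ring_1 fps"
  assumes q: "fps_X dvd q" and e: "fps_X ^ e dvd a * q ^ n"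
  shows "fps_cong e (qpoch_inf a q) (qpoch a q n)"
proof -
  \<comment> \<open>The limit is read off diagonally: coefficient \<open>i\<close> no longer changes
    once \<open>Suc i\<close> factors are present.\<close>
  define L where "L = Abs_fps (\<lambda>i. qpoch a q (Suc i) $ i)"
  have X: "fps_X ^ n dvd a * q ^ n" for n
    using q by (simp add: dvd_power_same)
  have cong: "fps_cong n (qpoch a q n) L" for n
    unfolding fps_cong_iff_nth
  proof safe
    fix i assume "i < n"
    then have "fps_cong (Suc i) (qpoch a q n) (qpoch a q (Suc i))"
      by (intro fps_cong_qpoch X) auto
    then show "qpoch a q n $ i = L $ i"
      by (simp add: fps_cong_iff_nth L_def)
  qed
  then have "qpoch_inf a q = L"
    unfolding qpoch_inf_def by (intro limI fps_LIMSEQ_if_cong)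
  \<comment> \<open>With \<open>max e n\<close> factors the product agrees with \<open>L\<close> to
    precision \<open>e\<close>, and it has enough factors to be cut back to \<open>n\<close> by
    \<open>e\<close>.\<close>
  moreover have "fps_cong e L (qpoch a q (max e n))"
    using cong[of "max e n"] by (auto intro: fps_cong_sym fps_cong_mono)
  moreover have "fps_cong e (qpoch a q (max e n)) (qpoch a q n)"
    by (rule fps_cong_qpoch[OF e]) auto
  ultimately show ?thesis
    using fps_cong_trans by blast
qed

lemma fps_cong_qpoch_inf_index:
  fixes a q :: "'a::comm_ring_1 fps"
  assumes "fps_X dvd q"
  shows "fps_cong n (qpoch_inf a q) (qpoch a q n)"
  using assms by (intro fps_cong_qpoch_inf) (simp_all add: dvd_power_same)

lemma qpoch_nth_0:
  fixes a q :: "'a::comm_ring_1 fps"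
  assumes "a $ 0 = 0"
  shows "qpoch a q n $ 0 = 1"
  using assms by (induction n) (simp_all add: qpoch_def)

lemma qpoch_inf_nth_0:
  fixes a q :: "'a::comm_ring_1 fps"
  assumes "fps_X dvd q" "a $ 0 = 0"
  shows "qpoch_inf a q $ 0 = 1"
  using fps_cong_qpoch_inf_index[OF assms(1), of 1 a] qpoch_nth_0[OF assms(2)]
  by (simp add: fps_cong_iff_nth)

section \<open>Identities between infinite products\<close>

lemma prod_lessThan_double:
  fixes f :: "nat \<Rightarrow> 'a::comm_monoid_mult"
  shows "(\<Prod>i<2 * n. f i) = (\<Prod>i<n. f (2 * i)) * (\<Prod>i<n. f (2 * i + 1))"
  by (induction n) (simp_all add: mult_ac)

text \<open>Sorting \<open>2 * n\<close> factors by the parity of their index is an exact identity,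
  which the congruences carry over to the limit.\<close>

lemma qpoch_inf_even_odd:
  fixes a q :: "'a::comm_ring_1 fps"
  assumes "fps_X dvd q"
  shows "qpoch_inf a q = qpoch_inf a (q\<^sup>2) * qpoch_inf (a * q) (q\<^sup>2)"
proof (rule fps_eq_if_cong)
  fix n
  have q2: "fps_X dvd q\<^sup>2"
    using assms by (simp add: power2_eq_square)
  have "fps_cong n (qpoch_inf a q) (qpoch a q (2 * n))"
    using fps_cong_qpoch_inf_index[OF assms, of "2 * n" a] by (rule fps_cong_mono) simp
  also have "qpoch a q (2 * n) = qpoch a (q\<^sup>2) n * qpoch (a * q) (q\<^sup>2) n"
    by (simp add: qpoch_def prod_lessThan_double power_mult mult.assoc)
  also have "fps_cong n \<dots> (qpoch_inf a (q\<^sup>2) * qpoch_inf (a * q) (q\<^sup>2))"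
    by (intro fps_cong_mult fps_cong_sym[OF fps_cong_qpoch_inf_index[OF q2]])
  finally show "fps_cong n (qpoch_inf a q) \<dots>" .
qed

text \<open>Factor by factor this is the difference of two squares.\<close>

lemma qpoch_inf_mult_uminus:
  fixes a q :: "'a::comm_ring_1 fps"
  assumes "fps_X dvd q"
  shows "qpoch_inf a q * qpoch_inf (- a) q = qpoch_inf (a\<^sup>2) (q\<^sup>2)"
proof (rule fps_eq_if_cong)
  fix n
  have q2: "fps_X dvd q\<^sup>2"
    using assms by (simp add: power2_eq_square)
  have "fps_cong n (qpoch_inf a q * qpoch_inf (- a) q) (qpoch a q n * qpoch (- a) q n)"
    by (intro fps_cong_mult fps_cong_qpoch_inf_index assms)
  also have "qpoch a q n * qpoch (- a) q n = qpoch (a\<^sup>2) (q\<^sup>2) n"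
    by (simp add: qpoch_def prod.distrib[symmetric] algebra_simps power2_eq_square power_mult_distrib)
  also have "fps_cong n \<dots> (qpoch_inf (a\<^sup>2) (q\<^sup>2))"
    by (rule fps_cong_sym[OF fps_cong_qpoch_inf_index[OF q2]])
  finally show "fps_cong n (qpoch_inf a q * qpoch_inf (- a) q) (qpoch_inf (a\<^sup>2) (q\<^sup>2))" .
qed

text \<open>Both \<open>(q;q)(-q;q) = (q^2;q^2)\<close> and \<open>(q;q) = (q;q^2)(q^2;q^2)\<close>
  hold; substitute the second into the first and cancel \<open>(q^2;q^2)\<close>, which has constant
  coefficient 1.\<close>

lemma euler_distinct_odd:
  fixes q :: "'a::field fps"
  assumes "fps_X dvd q"
  shows "qpoch_inf (- q) q * qpoch_inf q (q\<^sup>2) = 1"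
proof -
  have q2: "fps_X dvd q\<^sup>2" and "q $ 0 = 0"
    using assms by (auto simp: power2_eq_square dvd_def)
  then have "qpoch_inf (q\<^sup>2) (q\<^sup>2) $ 0 = 1"
    by (intro qpoch_inf_nth_0) (auto simp: power2_eq_square)
  then have "qpoch_inf (q\<^sup>2) (q\<^sup>2) \<noteq> 0"
    by auto
  moreover have "qpoch_inf (q\<^sup>2) (q\<^sup>2) * (qpoch_inf (- q) q * qpoch_inf q (q\<^sup>2)) = qpoch_inf (q\<^sup>2) (q\<^sup>2)"
    using qpoch_inf_mult_uminus[OF assms, of q] qpoch_inf_even_odd[OF assms, of q]
    by (simp add: power2_eq_square mult_ac)
  ultimately show ?thesis
    by simp
qed

section \<open>The theta function\<close>

text \<open>The Pascal recurrence defines the Gaussian binomial coefficient in any commutative ring,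
  without division.\<close>

fun gauss_binomial :: "'a::comm_ring_1 \<Rightarrow> nat \<Rightarrow> nat \<Rightarrow> 'a" where
  "gauss_binomial q n 0 = 1"
| "gauss_binomial q 0 (Suc k) = 0"
| "gauss_binomial q (Suc n) (Suc k) = gauss_binomial q n k + q ^ Suc k * gauss_binomial q n (Suc k)"

lemma gauss_binomial_eq_0: "n < k \<Longrightarrow> gauss_binomial q n k = 0"
  by (induction q n k rule: gauss_binomial.induct) auto

lemma gauss_binomial_self: "gauss_binomial q n n = 1"
  by (induction n) (auto simp: gauss_binomial_eq_0)

text \<open>This is the quotient formula with denominators cleared. After extracting
  \<open>qpoch q q n\<close>, the induction step is
  \<open>(1 - q^(k+1)) + q^(k+1) (1 - q^(n-k)) = 1 - q^(n+1)\<close>.\<close>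

lemma gauss_binomial_qpoch:
  "k \<le> n \<Longrightarrow> gauss_binomial q n k * qpoch q q k * qpoch q q (n - k) = qpoch q q n"
proof (induction q n k rule: gauss_binomial.induct)
  case (3 q n k)
  show ?case
  proof (cases "k = n")
    case True
    then show ?thesis
      using gauss_binomial_self[of q "Suc n"] by (simp add: qpoch_def)
  next
    case False
    with 3 have k: "Suc k \<le> n" by simp
    then have nk: "n - k = Suc (n - Suc k)" by simp
    let ?r = "qpoch q q (n - Suc k)"
    have "gauss_binomial q (Suc n) (Suc k) * qpoch q q (Suc k) * qpoch q q (Suc n - Suc k)
        = (gauss_binomial q n k * qpoch q q k * qpoch q q (n - k)) * (1 - q ^ Suc k)
          + q ^ Suc k * (gauss_binomial q n (Suc k) * qpoch q q (Suc k) * ?r) * (1 - q ^ (n - k))"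
      by (simp add: nk qpoch_Suc algebra_simps)
    also have "\<dots> = qpoch q q n * (1 - q ^ Suc k) + q ^ Suc k * qpoch q q n * (1 - q ^ (n - k))"
      using 3 k by simp
    also have "\<dots> = qpoch q q n * (1 - q ^ (Suc k + (n - k)))"
      by (simp only: power_add) (simp add: algebra_simps)
    also have "\<dots> = qpoch q q (Suc n)"
      using k by (simp add: qpoch_Suc)
    finally show ?thesis .
  qed
qed (auto simp: qpoch_def)

lemma choose_two_Suc: "Suc k choose 2 = k + (k choose 2)"
  by (simp add: numeral_2_eq_2)

text \<open>Splitting off the factor \<open>y + x\<close> leaves the same product for
  \<open>x * q\<close>, hence the induction for arbitrary \<open>x\<close>. Comparing coefficients
  then gives the Pascal recurrence.\<close>

lemma gauss_binomial_theorem: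
  "(\<Prod>i<n. y + x * q ^ i) =
     (\<Sum>k\<le>n. q ^ (k choose 2) * gauss_binomial q n k * x ^ k * y ^ (n - k))"
proof (induction n arbitrary: x)
  case (Suc n)
  let ?b = "\<lambda>n k. q ^ (k choose 2) * gauss_binomial q n k"
  let ?t = "\<lambda>k. ?b n k * (x * q) ^ k * y ^ (n - k)"
  \<comment> \<open>The added term \<open>k = Suc n\<close> has a vanishing binomial; it allows the
    index to be shifted without shortening the range.\<close>
  have "(\<Sum>k\<le>n. ?t k) = (\<Sum>k\<le>Suc n. ?t k)"
    by (simp add: gauss_binomial_eq_0)
  then have shift: "(\<Sum>k\<le>n. ?t k) = ?t 0 + (\<Sum>k\<le>n. ?t (Suc k))"
    by (simp only: sum.atMost_Suc_shift)
  have "(\<Prod>i<Suc n. y + x * q ^ i) = (y + x) * (\<Prod>i<n. y + (x * q) * q ^ i)"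
    by (simp only: prod.lessThan_Suc_shift) (simp add: mult.assoc)
  also have "\<dots> = y * (\<Sum>k\<le>n. ?t k) + x * (\<Sum>k\<le>n. ?t k)"
    by (simp only: Suc.IH distrib_right)
  also have "\<dots> = y * (?t 0 + (\<Sum>k\<le>n. ?t (Suc k))) + x * (\<Sum>k\<le>n. ?t k)"
    by (simp only: shift)
  also have "\<dots> = y * ?t 0 + (\<Sum>k\<le>n. y * ?t (Suc k) + x * ?t k)"
    by (simp only: sum.distrib sum_distrib_left distrib_left add.assoc)
  also have "(\<Sum>k\<le>n. y * ?t (Suc k) + x * ?t k)
      = (\<Sum>k\<le>n. ?b (Suc n) (Suc k) * x ^ Suc k * y ^ (Suc n - Suc k))"
  proof (intro sum.cong refl)
    fix k assume "k \<in> {..n}"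
    \<comment> \<open>For \<open>k = n\<close> the exponent \<open>n - Suc k\<close> is truncated
      and the powers of \<open>y\<close> do not match, but the binomial is zero.\<close>
    have "y * ?t (Suc k) = q ^ (Suc k choose 2) * (q ^ Suc k * gauss_binomial q n (Suc k))
        * x ^ Suc k * y ^ (n - k)"
    proof (cases "k = n")
      case True
      then show ?thesis by (simp add: gauss_binomial_eq_0)
    next
      case False
      with \<open>k \<in> {..n}\<close> have "n - k = Suc (n - Suc k)" by auto
      then show ?thesis by (simp add: power_mult_distrib mult_ac)
    qed
    moreover have "x * ?t k = q ^ (Suc k choose 2) * gauss_binomial q n k * x ^ Suc k * y ^ (n - k)"
      by (simp add: choose_two_Suc power_add power_mult_distrib mult_ac)
    ultimately show "y * ?t (Suc k) + x * ?t k
        = ?b (Suc n) (Suc k) * x ^ Suc k * y ^ (Suc n - Suc k)"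
      by (simp add: algebra_simps)
  qed
  also have "y * ?t 0 + \<dots> = (\<Sum>k\<le>Suc n. ?b (Suc n) k * x ^ k * y ^ (Suc n - k))"
    by (simp only: sum.atMost_Suc_shift) (simp add: numeral_2_eq_2)
  finally show ?case .
qed (simp add: numeral_2_eq_2)

text \<open>Substitute \<open>x = 1\<close>, \<open>y = q ^ (2n - 1)\<close> and base \<open>q\<^sup>2\<close> in the homogeneous \<open>q\<close>-binomial theorem with
  exponent \<open>2n\<close>, and cancel a power of \<open>q\<close>; this avoids negative powers of \<open>q\<close>.\<close>

lemma finite_triple_product:
  fixes q :: "'a::idom"
  assumes "q \<noteq> 0"
  shows "qpoch (- q) (q\<^sup>2) n ^ 2
    = (\<Sum>k\<le>2 * n. q ^ (nat ((int k - int n)\<^sup>2)) * gauss_binomial (q\<^sup>2) (2 * n) k)"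
proof (cases n)
  case 0
  then show ?thesis by (simp add: qpoch_def)
next
  case (Suc m)
  \<comment> \<open>The power of \<open>q\<close> to be cancelled: \<open>n * m\<close> comes from
    the first \<open>n\<close> factors, \<open>n * (2 * n - 1)\<close> from the last
    \<open>n\<close>.\<close>
  define e where "e = n * m + n * (2 * n - 1)"
  \<comment> \<open>For \<open>i < n\<close> the smaller exponent is \<open>2 * i\<close>; factoring
    it out leaves the factors of \<open>(-q;q^2)_n\<close> in reverse order.\<close>
  have neg: "(\<Prod>i<n. q ^ (2 * n - 1) + 1 * (q\<^sup>2) ^ i) = q ^ (n * m) * qpoch (- q) (q\<^sup>2) n"
  proof -
    have "(\<Prod>i<n. q ^ (2 * n - 1) + 1 * (q\<^sup>2) ^ i)
        = (\<Prod>i<n. q ^ (2 * i) * (1 + q * (q\<^sup>2) ^ (n - Suc i)))"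
    proof (intro prod.cong refl)
      fix i assume "i \<in> {..<n}"
      then have "2 * n - 1 = 2 * i + Suc (2 * (n - Suc i))" by auto
      then show "q ^ (2 * n - 1) + 1 * (q\<^sup>2) ^ i = q ^ (2 * i) * (1 + q * (q\<^sup>2) ^ (n - Suc i))"
        by (simp only: power_add power_mult power_Suc) (simp add: algebra_simps)
    qed
    also have "\<dots> = (\<Prod>i<n. q ^ (2 * i)) * (\<Prod>i<n. 1 + q * (q\<^sup>2) ^ (n - Suc i))"
      by (simp add: prod.distrib)
    also have "(\<Prod>i<n. 1 + q * (q\<^sup>2) ^ (n - Suc i)) = qpoch (- q) (q\<^sup>2) n"
      by (simp add: qpoch_def prod.nat_diff_reindex[where g = "\<lambda>i. 1 + q * (q\<^sup>2) ^ i"])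
    also have "(\<Prod>i<n. q ^ (2 * i)) = q ^ (n * (n - 1))"
    proof (induction n)
      case (Suc n)
      have "n * (n - 1) + 2 * n = Suc n * (Suc n - 1)" by (cases n) auto
      with Suc show ?case by (simp only: prod.lessThan_Suc power_add[symmetric])
    qed simp
    finally show ?thesis using Suc by simp
  qed
  \<comment> \<open>In the second half the smaller exponent is always \<open>2 * n - 1\<close>, and
    the factors appear in their natural order.\<close>
  have pos: "(\<Prod>i<n. q ^ (2 * n - 1) + 1 * (q\<^sup>2) ^ (n + i)) = q ^ (n * (2 * n - 1)) * qpoch (- q) (q\<^sup>2) n"
  proof -
    have "q ^ (2 * n - 1) + 1 * (q\<^sup>2) ^ (n + i) = q ^ (2 * n - 1) * (1 + q * (q\<^sup>2) ^ i)" for i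
    proof -
      have "2 * (n + i) = (2 * n - 1) + Suc (2 * i)" using Suc by simp
      then have "q ^ (2 * (n + i)) = q ^ (2 * n - 1) * (q * (q\<^sup>2) ^ i)"
        by (simp only: power_add power_mult power_Suc)
      then show ?thesis by (simp add: algebra_simps flip: power_mult)
    qed
    then show ?thesis
      by (simp add: prod.distrib qpoch_def power_mult[symmetric] mult.commute)
  qed
  have split: "(\<Prod>i<2 * n. f i) = (\<Prod>i<n. f i) * (\<Prod>i<n. f (n + i))" for f :: "nat \<Rightarrow> 'a"
    using prod.nat_group[of f n 2] prod.atLeastLessThan_shift_bounds[of f 0 n n]
    by (simp add: numeral_2_eq_2 lessThan_atLeast0 add.commute)
  have "q ^ e * qpoch (- q) (q\<^sup>2) n ^ 2 = (\<Prod>i<2 * n. q ^ (2 * n - 1) + 1 * (q\<^sup>2) ^ i)"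
    unfolding split neg pos e_def by (simp add: power2_eq_square power_add mult_ac)
  also have "\<dots> = (\<Sum>k\<le>2 * n. (q\<^sup>2) ^ (k choose 2) * gauss_binomial (q\<^sup>2) (2 * n) k
      * 1 ^ k * (q ^ (2 * n - 1)) ^ (2 * n - k))"
    by (rule gauss_binomial_theorem)
  also have "\<dots> = (\<Sum>k\<le>2 * n. q ^ e * (q ^ (nat ((int k - int n)\<^sup>2)) * gauss_binomial (q\<^sup>2) (2 * n) k))"
  proof (intro sum.cong refl)
    fix k assume k: "k \<in> {..2 * n}"
    have c: "int (2 * (k choose 2)) = int k * (int k - 1)"
      by (cases k) (simp_all add: choose_two algebra_simps)
    have i: "int (2 * n - 1) = 2 * int n - 1" "int m = int n - 1" "int (2 * n - k) = 2 * int n - int k"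
      "int (nat ((int k - int n)\<^sup>2)) = (int k - int n)\<^sup>2"
      using Suc k by auto
    \<comment> \<open>Both exponents equal \<open>k^2 - 2nk + 4n^2 - 2n\<close>. Over the integers
      no subtraction is truncated.\<close>
    have "int (2 * (k choose 2) + (2 * n - 1) * (2 * n - k)) = int (e + nat ((int k - int n)\<^sup>2))"
      unfolding of_nat_add of_nat_mult[of _ "2 * n - k"] of_nat_mult[of n] c i e_def
      by (simp add: algebra_simps power2_eq_square)
    then have "2 * (k choose 2) + (2 * n - 1) * (2 * n - k) = e + nat ((int k - int n)\<^sup>2)"
      by (simp only: of_nat_eq_iff)
    then have "(q\<^sup>2) ^ (k choose 2) * (q ^ (2 * n - 1)) ^ (2 * n - k) = q ^ e * q ^ nat ((int k - int n)\<^sup>2)"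
      by (simp flip: power_add power_mult)
    then show "(q\<^sup>2) ^ (k choose 2) * gauss_binomial (q\<^sup>2) (2 * n) k * 1 ^ k * (q ^ (2 * n - 1)) ^ (2 * n - k)
        = q ^ e * (q ^ (nat ((int k - int n)\<^sup>2)) * gauss_binomial (q\<^sup>2) (2 * n) k)"
      by (simp add: mult_ac)
  qed
  finally show ?thesis
    using assms by (simp add: sum_distrib_left[symmetric])
qed

section \<open>Passage to the limit in the triple product\<close>

text \<open>Each of \<open>k\<close>, \<open>n - k\<close> and \<open>n\<close> is at least
  \<open>m\<close>, so the three finite products in \<open>gauss_binomial_qpoch\<close> agree with
  \<open>qpoch_inf q q\<close> up to a multiple of \<open>q ^ Suc m\<close>. Cancelling one infinite
  product leaves the claim.\<close>

lemma fps_cong_gauss_binomial: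
  fixes q :: "'a::field fps"
  assumes "fps_X ^ Suc d dvd q" "m \<le> k" "m + k \<le> n"
  shows "fps_cong (Suc d * Suc m) (gauss_binomial q n k * qpoch_inf q q) 1"
proof -
  have X: "fps_X dvd q"
    using assms(1) by (auto simp: dvd_def mult.assoc)
  let ?P = "qpoch_inf q q" and ?b = "gauss_binomial q n k"
  have cong: "fps_cong (Suc d * Suc m) ?P (qpoch q q i)" if "m \<le> i" for i
  proof (rule fps_cong_qpoch_inf[OF X])
    have "fps_X ^ (Suc d * Suc i) dvd q ^ Suc i"
      using assms(1) by (simp only: power_mult dvd_power_same)
    moreover have "(fps_X :: 'a fps) ^ (Suc d * Suc m) dvd fps_X ^ (Suc d * Suc i)"
      using that by (intro le_imp_power_dvd mult_le_mono) auto
    ultimately show "fps_X ^ (Suc d * Suc m) dvd q * q ^ i"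
      using dvd_trans by fastforce
  qed
  have "fps_cong (Suc d * Suc m) (?b * ?P * ?P) (?b * qpoch q q k * qpoch q q (n - k))"
    using assms by (intro fps_cong_mult cong) auto
  also have "\<dots> = qpoch q q n"
    using assms by (intro gauss_binomial_qpoch) auto
  also have "fps_cong (Suc d * Suc m) \<dots> ?P"
    using assms by (intro fps_cong_sym[OF cong]) auto
  finally have "fps_cong (Suc d * Suc m) (?P * (?b * ?P)) (?P * 1)"
    by (simp add: mult_ac)
  then show ?thesis
    by (rule fps_cong_unit_cancel) (use X in \<open>auto simp: qpoch_inf_nth_0 dvd_def\<close>)
qed

text \<open>Reflection in the middle index \<open>n\<close> pairs all terms but the middle
  one.\<close>

lemma sum_centered_squares:
  fixes f :: "nat \<Rightarrow> 'a::comm_ring_1"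
  shows "(\<Sum>k\<le>2 * n. f (nat ((int k - int n)\<^sup>2))) = f 0 + 2 * (\<Sum>k = 1..n. f (k\<^sup>2))"
proof -
  let ?g = "\<lambda>k. f (nat ((int k - int n)\<^sup>2))"
  have g: "?g (n + k) = f (k\<^sup>2)" "k \<le> n \<Longrightarrow> ?g (n - k) = f (k\<^sup>2)" for k
    by (simp_all add: of_nat_diff nat_power_eq)
  have "{..2 * n} = {..<n} \<union> {n..2 * n}" by auto
  then have "sum ?g {..2 * n} = sum ?g {..<n} + sum ?g {n..2 * n}"
    by (simp add: sum.union_disjoint ivl_disj_int)
  also have "sum ?g {..<n} = (\<Sum>k = 1..n. ?g (n - k))"
    by (rule sum.reindex_bij_witness[of _ "\<lambda>k. n - k" "\<lambda>k. n - k"]) auto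
  also have "\<dots> = (\<Sum>k = 1..n. f (k\<^sup>2))"
    using g(2) by (intro sum.cong) auto
  also have "sum ?g {n..2 * n} = (\<Sum>k = 0..n. ?g (n + k))"
    by (rule sum.reindex_bij_witness[of _ "\<lambda>k. n + k" "\<lambda>k. k - n"]) auto
  also have "\<dots> = f 0 + (\<Sum>k = 1..n. f (k\<^sup>2))"
    unfolding g by (simp add: sum.atLeast_Suc_atMost)
  finally show ?thesis by simp
qed

text \<open>Replace each binomial of \<open>finite_triple_product\<close>, times
  \<open>(q^2;q^2)\<close>, by 1. This is least accurate near the ends of the range, where the large
  exponent of \<open>q\<close> makes up for it.\<close>

lemma fps_cong_theta:
  fixes q :: "'a::field fps"
  defines "q \<equiv> fps_X"
  shows "fps_cong n (1 + 2 * (\<Sum>k = 1..n. q ^ k\<^sup>2))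
    (qpoch_inf (- q) (q\<^sup>2) ^ 2 * qpoch_inf (q\<^sup>2) (q\<^sup>2))"
proof -
  let ?P = "qpoch_inf (q\<^sup>2) (q\<^sup>2)"
  have "1 + 2 * (\<Sum>k = 1..n. q ^ k\<^sup>2) = (\<Sum>k\<le>2 * n. q ^ nat ((int k - int n)\<^sup>2) * 1)"
    using sum_centered_squares[of "\<lambda>i. q ^ i" n] by simp
  also have "fps_cong n \<dots>
      (\<Sum>k\<le>2 * n. q ^ nat ((int k - int n)\<^sup>2) * (gauss_binomial (q\<^sup>2) (2 * n) k * ?P))"
  proof (rule fps_cong_sum)
    fix k assume k: "k \<in> {..2 * n}"
    \<comment> \<open>The distance of \<open>k\<close> from the nearer end of the range, which
      governs the accuracy of the binomial.\<close>
    define m where "m = (if k \<le> n then k else 2 * n - k)"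
    \<comment> \<open>With \<open>d = n - m\<close>, the distance of \<open>k\<close> from the
      middle, this follows from \<open>d \<le> d^2 + 1\<close>.\<close>
    have "n \<le> nat ((int k - int n)\<^sup>2) + Suc 1 * Suc m"
    proof -
      define d where "d = int n - int m"
      have d: "(int k - int n)\<^sup>2 = d\<^sup>2" "d \<ge> 0"
        using k by (auto simp: d_def m_def power2_commute power2_eq_square algebra_simps)
      have "d \<le> d\<^sup>2 + 1" using self_le_power[of d 2] d(2) by (cases "d = 0") auto
      then have "int n \<le> (int k - int n)\<^sup>2 + 2 * (int m + 1)"
        unfolding d(1) by (simp add: d_def)
      then show ?thesis by (simp add: nat_le_iff of_nat_le_iff[where 'a = int, symmetric] del: of_nat_le_iff)
    qed
    moreover have "fps_cong (Suc 1 * Suc m) (gauss_binomial (q\<^sup>2) (2 * n) k * ?P) 1"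
      by (rule fps_cong_gauss_binomial) (use k in \<open>auto simp: q_def m_def numeral_2_eq_2\<close>)
    then have "fps_cong (nat ((int k - int n)\<^sup>2) + Suc 1 * Suc m) (q ^ nat ((int k - int n)\<^sup>2) * 1)
        (q ^ nat ((int k - int n)\<^sup>2) * (gauss_binomial (q\<^sup>2) (2 * n) k * ?P))"
      unfolding q_def by (rule fps_cong_X_power_mult[OF fps_cong_sym])
    ultimately show "fps_cong n (q ^ nat ((int k - int n)\<^sup>2) * 1)
        (q ^ nat ((int k - int n)\<^sup>2) * (gauss_binomial (q\<^sup>2) (2 * n) k * ?P))"
      using fps_cong_mono by blast
  qed
  also have "\<dots> = qpoch (- q) (q\<^sup>2) n ^ 2 * ?P"
    by (subst finite_triple_product) (simp_all add: q_def sum_distrib_right mult.assoc)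
  also have "fps_cong n \<dots> (qpoch_inf (- q) (q\<^sup>2) ^ 2 * ?P)"
    by (intro fps_cong_mult fps_cong_power fps_cong_sym[OF fps_cong_qpoch_inf_index])
      (auto simp: q_def power2_eq_square)
  finally show ?thesis .
qed

section \<open>Partitions with prescribed multiplicities\<close>

text \<open>\<open>A j\<close> lists the allowed multiplicities of the part \<open>j\<close>. The
  bound \<open>N\<close> makes the generating function a finite product, open to induction.\<close>

definition bounded_parts :: "(nat \<Rightarrow> nat set) \<Rightarrow> nat \<Rightarrow> nat \<Rightarrow> nat multiset set" where
  "bounded_parts A N n =
     {M. set_mset M \<subseteq> {1..N} \<and> sum_mset M = n \<and> (\<forall>j\<in>{1..N}. count M j \<in> A j)}"

text \<open>For \<open>j > 0\<close> this is the sum of \<open>fps_X ^ (j * a)\<close> over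
  \<open>a\<close> in \<open>A\<close>, given by coefficients so that \<open>A\<close> may be
  infinite.\<close>

definition multiplicity_series :: "nat set \<Rightarrow> nat \<Rightarrow> 'a::comm_ring_1 fps" where
  "multiplicity_series A j = Abs_fps (\<lambda>m. if \<exists>a\<in>A. m = j * a then 1 else 0)"

lemma member_le_sum_mset:
  fixes x :: nat
  assumes "x \<in># M"
  shows "x \<le> sum_mset M"
  using multi_member_split[OF assms] by auto

lemma finite_bounded_parts: "finite (bounded_parts A N n)"
  by (rule finite_subset[OF _ finite_partitions[of n]]) (auto simp: bounded_parts_def partitions_def)

lemma filter_mset_Suc_bound:
  assumes "set_mset M \<subseteq> {1..Suc N}"
  shows "filter_mset (\<lambda>x. x \<le> N) M + replicate_mset (count M (Suc N)) (Suc N) = M"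
  using assms by (intro multiset_eqI) (auto simp: not_in_iff[symmetric] count_eq_zero_iff)

text \<open>Removing all copies of \<open>Suc N\<close> leaves a partition of some \<open>i\<close>,
  and \<open>n - i\<close> determines how many copies were removed.\<close>

lemma card_bounded_parts_Suc:
  "card (bounded_parts A (Suc N) n) =
     (\<Sum>i | i \<le> n \<and> (\<exists>a\<in>A (Suc N). n - i = Suc N * a). card (bounded_parts A N i))"
proof -
  let ?I = "{i. i \<le> n \<and> (\<exists>a\<in>A (Suc N). n - i = Suc N * a)}"
  have "bij_betw (filter_mset (\<lambda>x. x \<le> N)) (bounded_parts A (Suc N) n) (\<Union>i\<in>?I. bounded_parts A N i)"
  \<comment> \<open>The inverse map restores as many copies of \<open>Suc N\<close> as the missing
    weight requires.\<close>
  proof (rule bij_betw_byWitness[where f' = "\<lambda>M. M + replicate_mset ((n - sum_mset M) div Suc N) (Suc N)"])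
    have sum: "sum_mset (filter_mset (\<lambda>x. x \<le> N) M) + Suc N * count M (Suc N) = n"
      if "M \<in> bounded_parts A (Suc N) n" for M
    proof -
      have "sum_mset (filter_mset (\<lambda>x. x \<le> N) M + replicate_mset (count M (Suc N)) (Suc N)) = n"
        using that by (subst filter_mset_Suc_bound) (auto simp: bounded_parts_def)
      then show ?thesis by (simp add: algebra_simps)
    qed
    show "\<forall>M\<in>bounded_parts A (Suc N) n. filter_mset (\<lambda>x. x \<le> N) M
        + replicate_mset ((n - sum_mset (filter_mset (\<lambda>x. x \<le> N) M)) div Suc N) (Suc N) = M"
    proof
      fix M assume M: "M \<in> bounded_parts A (Suc N) n"
      have "(n - sum_mset (filter_mset (\<lambda>x. x \<le> N) M)) div Suc N = (Suc N * count M (Suc N)) div Suc N"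
        using sum[OF M] by (metis diff_add_inverse)
      then have "(n - sum_mset (filter_mset (\<lambda>x. x \<le> N) M)) div Suc N = count M (Suc N)"
        by (simp only: nonzero_mult_div_cancel_left[OF Suc_not_Zero])
      then show "filter_mset (\<lambda>x. x \<le> N) M
          + replicate_mset ((n - sum_mset (filter_mset (\<lambda>x. x \<le> N) M)) div Suc N) (Suc N) = M"
        using M filter_mset_Suc_bound[of M N] by (simp add: bounded_parts_def)
    qed
    show "\<forall>M\<in>(\<Union>i\<in>?I. bounded_parts A N i).
        filter_mset (\<lambda>x. x \<le> N) (M + replicate_mset ((n - sum_mset M) div Suc N) (Suc N)) = M"
    proof safe
      fix M i assume "M \<in> bounded_parts A N i"
      then have "filter_mset (\<lambda>x. x \<le> N) M = M"
        by (auto simp: bounded_parts_def filter_mset_eq_conv)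
      moreover have "filter_mset (\<lambda>x. x \<le> N) (replicate_mset a (Suc N)) = {#}" for a
        by (auto simp: filter_mset_eq_conv)
      ultimately show "filter_mset (\<lambda>x. x \<le> N) (M + replicate_mset ((n - sum_mset M) div Suc N) (Suc N)) = M"
        by simp
    qed
    show "filter_mset (\<lambda>x. x \<le> N) ` bounded_parts A (Suc N) n \<subseteq> (\<Union>i\<in>?I. bounded_parts A N i)"
    proof safe
      fix M assume M: "M \<in> bounded_parts A (Suc N) n"
      let ?M = "filter_mset (\<lambda>x. x \<le> N) M"
      have "?M \<in> bounded_parts A N (sum_mset ?M)"
        using M by (auto simp: bounded_parts_def)
      moreover have "sum_mset ?M \<le> n" "n - sum_mset ?M = Suc N * count M (Suc N)"
        using sum[OF M] by auto
      moreover have "count M (Suc N) \<in> A (Suc N)"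
        using M by (auto simp: bounded_parts_def)
      ultimately show "?M \<in> (\<Union>i\<in>?I. bounded_parts A N i)"
        by blast
    qed
    show "(\<lambda>M. M + replicate_mset ((n - sum_mset M) div Suc N) (Suc N)) ` (\<Union>i\<in>?I. bounded_parts A N i)
        \<subseteq> bounded_parts A (Suc N) n"
    proof safe
      fix M i a
      assume M: "M \<in> bounded_parts A N i" and a: "i \<le> n" "a \<in> A (Suc N)" "n - i = Suc N * a"
      have i: "sum_mset M = i" "Suc N \<notin># M" using M by (auto simp: bounded_parts_def)
      have d: "(n - sum_mset M) div Suc N = a"
        unfolding i a(3) by (rule nonzero_mult_div_cancel_left) simp
      have "sum_mset (M + replicate_mset a (Suc N)) = n"
        using i a by (simp add: algebra_simps)
      moreover have "count (M + replicate_mset a (Suc N)) j \<in> A j" if "j \<in> {1..Suc N}" for j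
        using that M i a by (cases "j = Suc N") (auto simp: bounded_parts_def not_in_iff)
      ultimately show "M + replicate_mset ((n - sum_mset M) div Suc N) (Suc N) \<in> bounded_parts A (Suc N) n"
        unfolding d using M by (auto simp: bounded_parts_def split: if_splits)
    qed
  qed
  then have "card (bounded_parts A (Suc N) n) = card (\<Union>i\<in>?I. bounded_parts A N i)"
    by (rule bij_betw_same_card)
  also have "\<dots> = (\<Sum>i\<in>?I. card (bounded_parts A N i))"
    by (rule card_UN_disjoint) (auto simp: finite_bounded_parts, auto simp: bounded_parts_def)
  finally show ?thesis .
qed

text \<open>The Cauchy product with the last factor is exactly the recurrence
  \<open>card_bounded_parts_Suc\<close>.\<close>

lemma prod_multiplicity_series_nth:
  "(\<Prod>j = 1..N. multiplicity_series (A j) j) $ n = of_nat (card (bounded_parts A N n))"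
proof (induction N arbitrary: n)
  case 0
  have "bounded_parts A 0 n = (if n = 0 then {{#}} else {})"
    by (auto simp: bounded_parts_def)
  then show ?case by simp
next
  case (Suc N)
  have "(\<Prod>j = 1..Suc N. multiplicity_series (A j) j :: 'a fps) $ n
      = (\<Sum>i = 0..n. of_nat (card (bounded_parts A N i)) *
          (if \<exists>a\<in>A (Suc N). n - i = Suc N * a then 1 else 0))"
    by (simp add: fps_mult_nth Suc.IH[simplified])
      (simp add: multiplicity_series_def)
  also have "\<dots> = (\<Sum>i | i \<le> n \<and> (\<exists>a\<in>A (Suc N). n - i = Suc N * a). of_nat (card (bounded_parts A N i)))"
    by (rule sum.mono_neutral_cong_right) auto
  finally show ?case by (simp add: card_bounded_parts_Suc)
qed

text \<open>A partition of \<open>n \<le> N\<close> has no part above \<open>N\<close>, so the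
  conditions on larger parts hold as soon as multiplicity 0 is allowed there.\<close>

lemma fps_cong_partition_series:
  assumes "\<And>j. N < j \<Longrightarrow> 0 \<in> A j"
  shows "fps_cong (Suc N)
    (Abs_fps (\<lambda>n. of_nat (card {M \<in> partitions n. \<forall>j>0. count M j \<in> A j})))
    (\<Prod>j = 1..N. multiplicity_series (A j) j)"
  unfolding fps_cong_iff_nth
proof safe
  fix n assume "n < Suc N"
  have "{M \<in> partitions n. \<forall>j>0. count M j \<in> A j} = bounded_parts A N n"
  proof (intro equalityI subsetI)
    fix M assume M: "M \<in> {M \<in> partitions n. \<forall>j>0. count M j \<in> A j}"
    have "j \<le> N" if "j \<in># M" for j
      using that M \<open>n < Suc N\<close> member_le_sum_mset[of j M] by (auto simp: partitions_def)
    moreover have "1 \<le> j" if "j \<in># M" for j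
      using that M by (cases j) (auto simp: partitions_def)
    ultimately show "M \<in> bounded_parts A N n"
      using M by (auto simp: bounded_parts_def partitions_def)
  next
    fix M assume M: "M \<in> bounded_parts A N n"
    have "count M j \<in> A j" if "j > 0" for j
    proof (cases "j \<le> N")
      case False
      then have "j \<notin># M" using M by (auto simp: bounded_parts_def)
      then show ?thesis using assms[of j] False by (simp add: not_in_iff)
    qed (use M that in \<open>auto simp: bounded_parts_def\<close>)
    then show "M \<in> {M \<in> partitions n. \<forall>j>0. count M j \<in> A j}"
      using M by (auto simp: bounded_parts_def partitions_def)
  qed
  then show "Abs_fps (\<lambda>n. of_nat (card {M \<in> partitions n. \<forall>j>0. count M j \<in> A j})) $ n
      = (\<Prod>j = 1..N. multiplicity_series (A j) j) $ n"
    by (simp only: prod_multiplicity_series_nth fps_nth_Abs_fps)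
qed

text \<open>The geometric series, in a form without division.\<close>

lemma multiplicity_series_UNIV:
  assumes "j > 0"
  shows "multiplicity_series UNIV j * (1 - fps_X ^ j) = 1"
proof (rule fps_ext)
  fix n
  have "(\<exists>a. n = j * a) \<longleftrightarrow> n = 0 \<or> (j \<le> n \<and> (\<exists>a. n - j = j * a))"
  proof
    assume "\<exists>a. n = j * a"
    then obtain a where "n = j * a" ..
    then show "n = 0 \<or> (j \<le> n \<and> (\<exists>a. n - j = j * a))"
      by (cases a) auto
  next
    assume "n = 0 \<or> (j \<le> n \<and> (\<exists>a. n - j = j * a))"
    then show "\<exists>a. n = j * a"
      by (metis le_add_diff_inverse mult_Suc_right mult_0_right)
  qed
  then show "(multiplicity_series UNIV j * (1 - fps_X ^ j)) $ n = (1 :: 'a fps) $ n"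
    using assms by (auto simp: right_diff_distrib fps_X_power_mult_right_nth multiplicity_series_def)
qed

lemma multiplicity_series_positive:
  assumes "j > 0"
  shows "multiplicity_series {1..} j = fps_X ^ j * multiplicity_series UNIV j"
proof (rule fps_ext)
  fix n
  have "(\<exists>a\<in>{1..}. n = j * a) \<longleftrightarrow> j \<le> n \<and> (\<exists>a. n - j = j * a)"
  proof
    assume "\<exists>a\<in>{1..}. n = j * a"
    then obtain a where "n = j * a" "a \<ge> 1" by auto
    then show "j \<le> n \<and> (\<exists>a. n - j = j * a)"
      by (cases a) auto
  next
    assume "j \<le> n \<and> (\<exists>a. n - j = j * a)"
    then obtain a where "j \<le> n" "n - j = j * a" by auto
    then show "\<exists>a\<in>{1..}. n = j * a"
      by (intro bexI[of _ "Suc a"]) auto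
  qed
  then show "multiplicity_series {1..} j $ n = (fps_X ^ j * multiplicity_series UNIV j :: 'a fps) $ n"
    by (auto simp: fps_X_power_mult_nth multiplicity_series_def)
qed

lemma multiplicity_series_1: "multiplicity_series {1} j = fps_X ^ j"
  by (auto simp: fps_eq_iff multiplicity_series_def fps_X_power_nth)

lemma multiplicity_series_01:
  assumes "j > 0"
  shows "multiplicity_series {0, 1} j = 1 + fps_X ^ j"
  using assms by (auto simp: fps_eq_iff multiplicity_series_def fps_X_power_nth)

lemma prod_1_double:
  fixes f :: "nat \<Rightarrow> 'a::comm_monoid_mult"
  shows "(\<Prod>j = 1..2 * N. f j) = (\<Prod>i<N. f (2 * i + 1)) * (\<Prod>i<N. f (2 * i + 2))"
  by (induction N) (simp_all add: mult_ac)

text \<open>Exchanging the first \<open>k\<close> factors \<open>g\<close> for \<open>f\<close>,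
  cross-multiplied to avoid division. For even runs the \<open>g\<close> on the left form
  \<open>(-q^2;q^2)_k\<close>.\<close>

lemma prod_if_less:
  fixes f g :: "nat \<Rightarrow> 'a::comm_monoid_mult"
  assumes "k \<le> N"
  shows "(\<Prod>i<N. if i < k then f i else g i) * (\<Prod>i<k. g i) = (\<Prod>i<k. f i) * (\<Prod>i<N. g i)"
  using assms by (induction N rule: dec_induct) (auto simp: mult_ac intro!: prod.cong)

section \<open>Partitions containing an initial run of odd or even parts\<close>

definition odd_run_series :: "nat \<Rightarrow> 'a::comm_ring_1 fps" where
  "odd_run_series k = Abs_fps (\<lambda>n. of_nat (card {M \<in> P_ed n. \<forall>i<k. 2 * i + 1 \<in># M}))"

definition even_run_series :: "nat \<Rightarrow> 'a::comm_ring_1 fps" where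
  "even_run_series k = Abs_fps (\<lambda>n. of_nat (card {M \<in> P_ed n. \<forall>i<k. 2 * i + 2 \<in># M}))"

text \<open>The condition in \<open>P_ed\<close> also ranges over the even number 0, whereas the
  multiplicity sets constrain positive parts only.\<close>

lemma count_partition_zero: "M \<in> partitions n \<Longrightarrow> count M 0 = 0"
  by (auto simp: partitions_def not_in_iff)

text \<open>After multiplication by \<open>(q;q^2)\<close>, a required odd part \<open>j\<close>
  contributes \<open>q ^ j\<close>, any other odd part 1, and an even part \<open>1 + q ^ j\<close>.
  The required parts add up to \<open>1 + 3 + ... + (2k - 1) = k^2\<close>.\<close>

lemma odd_run_series_eq:
  fixes q :: "'a::field fps"
  defines "q \<equiv> fps_X"
  shows "odd_run_series k * qpoch_inf q (q\<^sup>2) = q ^ k\<^sup>2 * qpoch_inf (- (q\<^sup>2)) (q\<^sup>2)"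
proof (rule fps_eq_if_cong)
  fix n
  define A :: "nat \<Rightarrow> nat set" where
    "A j = (if even j then {0, 1} else if j < 2 * k then {1..} else UNIV)" for j
  \<comment> \<open>Large enough for precision \<open>n\<close> and for the first
    \<open>2 * N\<close> parts to include all required ones.\<close>
  define N where "N = n + k"
  have q2: "fps_X dvd q\<^sup>2" by (simp add: q_def power2_eq_square)
  have "{M \<in> P_ed m. \<forall>i<k. 2 * i + 1 \<in># M} = {M \<in> partitions m. \<forall>j>0. count M j \<in> A j}" for m
  proof (intro Collect_cong)
    fix M
    have "(\<forall>j. even j \<longrightarrow> count M j \<le> 1) \<and> (\<forall>i<k. 2 * i + 1 \<in># M) \<longleftrightarrow> (\<forall>j>0. count M j \<in> A j)"
      if "M \<in> partitions m"
    proof (intro iffI conjI allI impI)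
      fix j :: nat assume *: "(\<forall>j. even j \<longrightarrow> count M j \<le> 1) \<and> (\<forall>i<k. 2 * i + 1 \<in># M)" "j > 0"
      show "count M j \<in> A j"
      proof (cases "even j")
        case True
        then have "count M j \<le> 1" using * by blast
        then show ?thesis using True by (auto simp: A_def)
      next
        case False
        then obtain i where "j = 2 * i + 1" by (auto elim: oddE)
        then show ?thesis using * by (auto simp: A_def Suc_le_eq)
      qed
    next
      fix j :: nat assume *: "\<forall>j>0. count M j \<in> A j" "even j"
      show "count M j \<le> 1"
        using *(1)[rule_format, of j] *(2) count_partition_zero[OF that]
        by (cases "j = 0") (auto simp: A_def)
    next
      fix i assume *: "\<forall>j>0. count M j \<in> A j" "i < k"
      then have "count M (2 * i + 1) \<in> A (2 * i + 1)" by simp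
      then show "2 * i + 1 \<in># M"
        using *(2) by (auto simp: A_def not_in_iff[symmetric] Suc_le_eq)
    qed
    then show "M \<in> P_ed m \<and> (\<forall>i<k. 2 * i + 1 \<in># M) \<longleftrightarrow> M \<in> partitions m \<and> (\<forall>j>0. count M j \<in> A j)"
      by (auto simp: P_ed_def)
  qed
  moreover have "0 \<in> A j" if "2 * N < j" for j
    using that by (auto simp: A_def N_def)
  ultimately have "fps_cong (Suc (2 * N)) (odd_run_series k) (\<Prod>j = 1..2 * N. multiplicity_series (A j) j :: 'a fps)"
    using fps_cong_partition_series[of "2 * N" A] by (simp add: odd_run_series_def)
  then have "fps_cong n (odd_run_series k) (\<Prod>j = 1..2 * N. multiplicity_series (A j) j :: 'a fps)"
    by (rule fps_cong_mono) (simp add: N_def)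
  moreover have "fps_cong n (qpoch_inf q (q\<^sup>2)) (qpoch q (q\<^sup>2) N)"
    by (rule fps_cong_mono[OF fps_cong_qpoch_inf_index[OF q2]]) (simp add: N_def)
  ultimately have "fps_cong n (odd_run_series k * qpoch_inf q (q\<^sup>2))
      ((\<Prod>j = 1..2 * N. multiplicity_series (A j) j) * qpoch q (q\<^sup>2) N)"
    by (rule fps_cong_mult)
  also have "(\<Prod>j = 1..2 * N. multiplicity_series (A j) j) * qpoch q (q\<^sup>2) N
      = (\<Prod>i<N. multiplicity_series (A (2 * i + 1)) (2 * i + 1) * (1 - q * (q\<^sup>2) ^ i))
        * (\<Prod>i<N. multiplicity_series (A (2 * i + 2)) (2 * i + 2))"
    unfolding prod_1_double qpoch_def prod.distrib by (simp only: mult_ac)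
  also have "(\<Prod>i<N. multiplicity_series (A (2 * i + 2)) (2 * i + 2)) = qpoch (- (q\<^sup>2)) (q\<^sup>2) N"
    unfolding qpoch_def
  proof (intro prod.cong refl)
    fix i
    have "A (2 * i + 2) = {0, 1}" by (simp add: A_def)
    then show "multiplicity_series (A (2 * i + 2)) (2 * i + 2) = 1 - - (q\<^sup>2) * (q\<^sup>2) ^ i"
      by (simp only: multiplicity_series_01) (simp add: q_def flip: power_mult power_add)
  qed
  also have "(\<Prod>i<N. multiplicity_series (A (2 * i + 1)) (2 * i + 1) * (1 - q * (q\<^sup>2) ^ i))
      = (\<Prod>i<N. if i < k then q ^ (2 * i + 1) else 1)"
  proof (intro prod.cong refl)
    fix i
    have q: "1 - q * (q\<^sup>2) ^ i = 1 - fps_X ^ (2 * i + 1)"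
      by (simp add: q_def power_mult)
    have A: "A (2 * i + 1) = (if i < k then {1..} else UNIV)"
      by (auto simp: A_def)
    show "multiplicity_series (A (2 * i + 1)) (2 * i + 1) * (1 - q * (q\<^sup>2) ^ i)
        = (if i < k then q ^ (2 * i + 1) else 1)"
      unfolding A q using multiplicity_series_UNIV[of "2 * i + 1", where 'a = 'a]
        multiplicity_series_positive[of "2 * i + 1", where 'a = 'a]
      by (simp add: q_def mult.assoc)
  qed
  also have "\<dots> = (\<Prod>i<k. q ^ (2 * i + 1))"
    using prod_if_less[of k N "\<lambda>i. q ^ (2 * i + 1)" "\<lambda>_. 1"] by (simp add: N_def)
  also have "\<dots> = q ^ k\<^sup>2"
  proof (induction k)
    case (Suc k)
    have "k\<^sup>2 + (2 * k + 1) = (Suc k)\<^sup>2" by (simp add: power2_eq_square)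
    with Suc show ?case by (simp only: prod.lessThan_Suc power_add[symmetric])
  qed simp
  also have "fps_cong n (q ^ k\<^sup>2 * qpoch (- (q\<^sup>2)) (q\<^sup>2) N) (q ^ k\<^sup>2 * qpoch_inf (- (q\<^sup>2)) (q\<^sup>2))"
    by (rule fps_cong_mult[OF _ fps_cong_sym[OF fps_cong_mono[OF fps_cong_qpoch_inf_index[OF q2]]]])
      (simp_all add: N_def)
  finally show "fps_cong n (odd_run_series k * qpoch_inf q (q\<^sup>2)) (q ^ k\<^sup>2 * qpoch_inf (- (q\<^sup>2)) (q\<^sup>2))" .
qed

text \<open>A required even part occurs exactly once and contributes \<open>q ^ j\<close> in place
  of \<open>1 + q ^ j\<close>; the factor \<open>(-q^2;q^2)_k\<close> supplies the missing terms.
  The required parts add up to \<open>2 + 4 + ... + 2k = k (k + 1)\<close>.\<close>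

lemma even_run_series_eq:
  fixes q :: "'a::field fps"
  defines "q \<equiv> fps_X"
  shows "even_run_series k * qpoch_inf q (q\<^sup>2) * qpoch (- (q\<^sup>2)) (q\<^sup>2) k
    = q ^ (k * (k + 1)) * qpoch_inf (- (q\<^sup>2)) (q\<^sup>2)"
proof (rule fps_eq_if_cong)
  fix n
  define A :: "nat \<Rightarrow> nat set" where
    "A j = (if odd j then UNIV else if j \<le> 2 * k then {1} else {0, 1})" for j
  define N where "N = n + k"
  have q2: "fps_X dvd q\<^sup>2" by (simp add: q_def power2_eq_square)
  have "{M \<in> P_ed m. \<forall>i<k. 2 * i + 2 \<in># M} = {M \<in> partitions m. \<forall>j>0. count M j \<in> A j}" for m
  proof (intro Collect_cong)
    fix M
    have "(\<forall>j. even j \<longrightarrow> count M j \<le> 1) \<and> (\<forall>i<k. 2 * i + 2 \<in># M) \<longleftrightarrow> (\<forall>j>0. count M j \<in> A j)"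
      if "M \<in> partitions m"
    proof (intro iffI conjI allI impI)
      fix j :: nat assume *: "(\<forall>j. even j \<longrightarrow> count M j \<le> 1) \<and> (\<forall>i<k. 2 * i + 2 \<in># M)" "j > 0"
      show "count M j \<in> A j"
      proof (cases "even j")
        case True
        then obtain l where "j = 2 * l" by blast
        with \<open>j > 0\<close> obtain i where i: "j = 2 * i + 2" by (cases l) auto
        have "count M j \<le> 1" using * True by blast
        moreover have "count M j > 0" if "j \<le> 2 * k"
          using * that i by simp
        ultimately show ?thesis
          using True by (cases "j \<le> 2 * k") (auto simp: A_def le_Suc_eq simp del: count_greater_zero_iff)
      qed (simp add: A_def)
    next
      fix j :: nat assume *: "\<forall>j>0. count M j \<in> A j" "even j"
      show "count M j \<le> 1"
        using *(1)[rule_format, of j] *(2) count_partition_zero[OF that]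
        by (cases "j = 0") (auto simp: A_def split: if_splits)
    next
      fix i assume *: "\<forall>j>0. count M j \<in> A j" "i < k"
      then have "count M (2 * i + 2) \<in> A (2 * i + 2)" by simp
      then show "2 * i + 2 \<in># M"
        using *(2) by (auto simp: A_def intro: ccontr simp: not_in_iff)
    qed
    then show "M \<in> P_ed m \<and> (\<forall>i<k. 2 * i + 2 \<in># M) \<longleftrightarrow> M \<in> partitions m \<and> (\<forall>j>0. count M j \<in> A j)"
      by (auto simp: P_ed_def)
  qed
  moreover have "0 \<in> A j" if "2 * N < j" for j
    using that by (auto simp: A_def N_def)
  ultimately have "fps_cong (Suc (2 * N)) (even_run_series k) (\<Prod>j = 1..2 * N. multiplicity_series (A j) j :: 'a fps)"
    using fps_cong_partition_series[of "2 * N" A] by (simp add: even_run_series_def)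
  then have "fps_cong n (even_run_series k) (\<Prod>j = 1..2 * N. multiplicity_series (A j) j :: 'a fps)"
    by (rule fps_cong_mono) (simp add: N_def)
  moreover have "fps_cong n (qpoch_inf q (q\<^sup>2)) (qpoch q (q\<^sup>2) N)"
    by (rule fps_cong_mono[OF fps_cong_qpoch_inf_index[OF q2]]) (simp add: N_def)
  ultimately have "fps_cong n (even_run_series k * qpoch_inf q (q\<^sup>2) * qpoch (- (q\<^sup>2)) (q\<^sup>2) k)
      ((\<Prod>j = 1..2 * N. multiplicity_series (A j) j) * qpoch q (q\<^sup>2) N * qpoch (- (q\<^sup>2)) (q\<^sup>2) k)"
    by (intro fps_cong_mult fps_cong_refl)
  also have "(\<Prod>j = 1..2 * N. multiplicity_series (A j) j) * qpoch q (q\<^sup>2) N * qpoch (- (q\<^sup>2)) (q\<^sup>2) k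
      = (\<Prod>i<N. multiplicity_series (A (2 * i + 1)) (2 * i + 1) * (1 - q * (q\<^sup>2) ^ i))
        * ((\<Prod>i<N. multiplicity_series (A (2 * i + 2)) (2 * i + 2)) * (\<Prod>i<k. 1 - - (q\<^sup>2) * (q\<^sup>2) ^ i))"
    unfolding prod_1_double qpoch_def prod.distrib by (simp only: mult_ac)
  also have "(\<Prod>i<N. multiplicity_series (A (2 * i + 1)) (2 * i + 1) * (1 - q * (q\<^sup>2) ^ i)) = 1"
  proof (intro prod.neutral ballI)
    fix i
    have q: "1 - q * (q\<^sup>2) ^ i = 1 - fps_X ^ (2 * i + 1)"
      by (simp add: q_def power_mult)
    have A: "A (2 * i + 1) = UNIV"
      by (auto simp: A_def)
    show "multiplicity_series (A (2 * i + 1)) (2 * i + 1) * (1 - q * (q\<^sup>2) ^ i) = 1"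
      unfolding A q by (rule multiplicity_series_UNIV) simp
  qed
  also have "(\<Prod>i<N. multiplicity_series (A (2 * i + 2)) (2 * i + 2))
      = (\<Prod>i<N. if i < k then q ^ (2 * i + 2) else 1 - - (q\<^sup>2) * (q\<^sup>2) ^ i)"
  proof (intro prod.cong refl)
    fix i
    have q: "1 - - (q\<^sup>2) * (q\<^sup>2) ^ i = 1 + fps_X ^ (2 * i + 2)"
      by (simp add: q_def flip: power_mult power_add)
    have A: "A (2 * i + 2) = (if i < k then {1} else {0, 1})"
      by (auto simp: A_def)
    show "multiplicity_series (A (2 * i + 2)) (2 * i + 2)
        = (if i < k then q ^ (2 * i + 2) else 1 - - (q\<^sup>2) * (q\<^sup>2) ^ i)"
      unfolding A q using multiplicity_series_01[of "2 * i + 2", where 'a = 'a]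
        multiplicity_series_1[of "2 * i + 2", where 'a = 'a]
      by (auto simp: q_def)
  qed
  also have "\<dots> * (\<Prod>i<k. 1 - - (q\<^sup>2) * (q\<^sup>2) ^ i) = (\<Prod>i<k. q ^ (2 * i + 2)) * qpoch (- (q\<^sup>2)) (q\<^sup>2) N"
    unfolding qpoch_def by (rule prod_if_less) (simp add: N_def)
  also have "(\<Prod>i<k. q ^ (2 * i + 2)) = q ^ (k * (k + 1))"
  proof (induction k)
    case (Suc k)
    have "k * (k + 1) + (2 * k + 2) = Suc k * (Suc k + 1)" by simp
    with Suc show ?case by (simp only: prod.lessThan_Suc power_add[symmetric])
  qed simp
  also have "fps_cong n (1 * (q ^ (k * (k + 1)) * qpoch (- (q\<^sup>2)) (q\<^sup>2) N))
      (q ^ (k * (k + 1)) * qpoch_inf (- (q\<^sup>2)) (q\<^sup>2))"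
    unfolding mult_1_left
    by (rule fps_cong_mult[OF _ fps_cong_sym[OF fps_cong_mono[OF fps_cong_qpoch_inf_index[OF q2]]]])
      (simp_all add: N_def)
  finally show "fps_cong n (even_run_series k * qpoch_inf q (q\<^sup>2) * qpoch (- (q\<^sup>2)) (q\<^sup>2) k)
    (q ^ (k * (k + 1)) * qpoch_inf (- (q\<^sup>2)) (q\<^sup>2))" .
qed

section \<open>Sums of minimal excludants\<close>

text \<open>If \<open>m\<close> is the least index with \<open>p m\<close> missing, the runs present
  are those of length at most \<open>m\<close>. Any \<open>N\<close> bounding the size of
  \<open>M\<close> will do, so one \<open>N\<close> serves many partitions at once.\<close>

lemma card_initial_runs:
  fixes p :: "nat \<Rightarrow> nat"
  assumes "\<And>i. i < p i" "sum_mset M \<le> N"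
  shows "(LEAST i. p i \<notin># M) = card {k \<in> {1..N}. \<forall>i<k. p i \<in># M}"
    and "p (LEAST i. p i \<notin># M) \<notin># M"
proof -
  define m where "m = (LEAST i. p i \<notin># M)"
  have bound: "p i \<le> N" if "p i \<in># M" for i
    using member_le_sum_mset[OF that] assms(2) by linarith
  \<comment> \<open>Since \<open>p N\<close> exceeds the size of \<open>M\<close>, it cannot be a
    part. This shows that the least index exists and is at most \<open>N\<close>.\<close>
  have "p N \<notin># M"
    using bound[of N] assms(1)[of N] by auto
  then have m: "p m \<notin># M" "m \<le> N"
    unfolding m_def by (rule LeastI, rule Least_le)
  have less: "p i \<in># M" if "i < m" for i
    using that not_less_Least unfolding m_def by blast
  have "(\<forall>i<k. p i \<in># M) \<longleftrightarrow> k \<le> m" for k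
  proof
    assume "\<forall>i<k. p i \<in># M"
    then show "k \<le> m" using m(1) by (cases "m < k") auto
  qed (use less in auto)
  then have "{k \<in> {1..N}. \<forall>i<k. p i \<in># M} = {1..m}"
    using m by auto
  then have "card {k \<in> {1..N}. \<forall>i<k. p i \<in># M} = m"
    by (simp only: card_atLeastAtMost diff_Suc_1)
  then show "(LEAST i. p i \<notin># M) = card {k \<in> {1..N}. \<forall>i<k. p i \<in># M}"
    unfolding m_def by (rule sym)
  show "p (LEAST i. p i \<notin># M) \<notin># M"
    using m(1) unfolding m_def .
qed

lemma moex_eq:
  assumes "sum_mset M \<le> N"
  shows "moex M = 1 + 2 * card {k \<in> {1..N}. \<forall>i<k. 2 * i + 1 \<in># M}"
proof -
  let ?m = "LEAST i. 2 * i + 1 \<notin># M"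
  have "moex M = 2 * ?m + 1"
    unfolding moex_def
  proof (rule Least_equality)
    show "odd (2 * ?m + 1) \<and> 2 * ?m + 1 \<notin># M"
      using card_initial_runs(2)[of "\<lambda>i. 2 * i + 1", OF _ assms] by simp
    show "2 * ?m + 1 \<le> y" if y: "odd y \<and> y \<notin># M" for y
    proof -
      obtain i where "y = 2 * i + 1" using y by (auto elim: oddE)
      then show ?thesis using y by (auto intro: Least_le)
    qed
  qed
  then show ?thesis
    using card_initial_runs(1)[of "\<lambda>i. 2 * i + 1", OF _ assms] by simp
qed

lemma meex_eq:
  assumes "sum_mset M \<le> N"
  shows "meex M = 2 + 2 * card {k \<in> {1..N}. \<forall>i<k. 2 * i + 2 \<in># M}"
proof -
  let ?m = "LEAST i. 2 * i + 2 \<notin># M"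
  have "meex M = 2 * ?m + 2"
    unfolding meex_def
  proof (rule Least_equality)
    show "0 < 2 * ?m + 2 \<and> even (2 * ?m + 2) \<and> 2 * ?m + 2 \<notin># M"
      using card_initial_runs(2)[of "\<lambda>i. 2 * i + 2", OF _ assms] by simp
    show "2 * ?m + 2 \<le> y" if y: "0 < y \<and> even y \<and> y \<notin># M" for y
    proof -
      obtain j where "y = 2 * j" using y by auto
      with y obtain i where "y = 2 * i + 2" by (cases j) auto
      then show ?thesis using y by (auto intro: Least_le)
    qed
  qed
  then show ?thesis
    using card_initial_runs(1)[of "\<lambda>i. 2 * i + 2", OF _ assms] by simp
qed

lemma sum_card_filter_swap:
  assumes "finite A" "finite B"
  shows "(\<Sum>x\<in>A. card {y \<in> B. R x y}) = (\<Sum>y\<in>B. card {x \<in> A. R x y})"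
  using sum_multicount_gen[OF assms, of R "\<lambda>y. card {x \<in> A. R x y}"] by auto

text \<open>Double counting of pairs of a partition and a run in it. The void condition for
  \<open>k = 0\<close> makes \<open>odd_run_series 0\<close> count all of
  \<open>P_ed\<close>.\<close>

lemma fps_cong_sigma_ed_moex:
  "fps_cong (Suc N) (Abs_fps (\<lambda>n. of_nat (sigma_ed_moex n)))
     (odd_run_series 0 + 2 * (\<Sum>k = 1..N. odd_run_series k))"
  unfolding fps_cong_iff_nth
proof safe
  fix n assume "n < Suc N"
  then have "sigma_ed_moex n = (\<Sum>M\<in>P_ed n. 1 + 2 * card {k \<in> {1..N}. \<forall>i<k. 2 * i + 1 \<in># M})"
    unfolding sigma_ed_moex_def by (intro sum.cong moex_eq) (auto simp: P_ed_def partitions_def)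
  also have "\<dots> = card (P_ed n) + 2 * (\<Sum>k = 1..N. card {M \<in> P_ed n. \<forall>i<k. 2 * i + 1 \<in># M})"
    unfolding sum.distrib sum_distrib_left[symmetric]
      sum_card_filter_swap[OF finite_P_ed finite_atLeastAtMost] by simp
  finally show "Abs_fps (\<lambda>n. of_nat (sigma_ed_moex n)) $ n
      = (odd_run_series 0 + 2 * (\<Sum>k = 1..N. odd_run_series k)) $ n"
    by (simp add: odd_run_series_def fps_sum_nth numeral_fps_const)
qed

text \<open>Here the constant 2 in \<open>meex_eq\<close> is absorbed as the term
  \<open>k = 0\<close>, which yields partial sums over \<open>k < N\<close> as in an infinite
  series.\<close>

lemma fps_cong_sigma_ed_meex:
  "fps_cong N (Abs_fps (\<lambda>n. of_nat (sigma_ed_meex n))) (2 * (\<Sum>k<N. even_run_series k))"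
proof (cases N)
  case (Suc L)
  have "fps_cong (Suc L) (Abs_fps (\<lambda>n. of_nat (sigma_ed_meex n)))
      (2 * (even_run_series 0 + (\<Sum>k = 1..L. even_run_series k)))"
    unfolding fps_cong_iff_nth
  proof safe
    fix n assume "n < Suc L"
    then have "sigma_ed_meex n = (\<Sum>M\<in>P_ed n. 2 + 2 * card {k \<in> {1..L}. \<forall>i<k. 2 * i + 2 \<in># M})"
      unfolding sigma_ed_meex_def by (intro sum.cong meex_eq) (auto simp: P_ed_def partitions_def)
    also have "\<dots> = 2 * (card (P_ed n) + (\<Sum>k = 1..L. card {M \<in> P_ed n. \<forall>i<k. 2 * i + 2 \<in># M}))"
      unfolding sum.distrib sum_distrib_left[symmetric]
        sum_card_filter_swap[OF finite_P_ed finite_atLeastAtMost] by simp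
    finally show "Abs_fps (\<lambda>n. of_nat (sigma_ed_meex n)) $ n
        = (2 * (even_run_series 0 + (\<Sum>k = 1..L. even_run_series k))) $ n"
      by (simp add: even_run_series_def fps_sum_nth numeral_fps_const distrib_left)
  qed
  also have "even_run_series 0 + (\<Sum>k = 1..L. even_run_series k) = (\<Sum>k<N. even_run_series k)"
    unfolding Suc lessThan_Suc_atMost atMost_atLeast0 by (simp add: sum.atLeast_Suc_atMost)
  finally show ?thesis using Suc by simp
qed (simp add: fps_cong_def)

section \<open>The two generating functions\<close>

lemma fps_divide_eqI:
  fixes f g h :: "'a::field fps"
  assumes "h * g = f" "g $ 0 \<noteq> 0"
  shows "h = f / g"
  using assms by (auto simp: fps_divide_unit mult.assoc inverse_mult_eq_1')

lemma sigma_ed_moex_series: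
  fixes q :: "'a::field fps"
  defines "q \<equiv> fps_X"
  shows "Abs_fps (\<lambda>n. of_nat (sigma_ed_moex n)) =
    qpoch_inf (q\<^sup>2) (q\<^sup>2) ^ 2 * qpoch_inf (- q) q ^ 3 / qpoch_inf (q ^ 4) (q ^ 4)"
proof (rule fps_divide_eqI)
  let ?G = "Abs_fps (\<lambda>n. of_nat (sigma_ed_moex n)) :: 'a fps"
  let ?P = "qpoch_inf (q\<^sup>2) (q\<^sup>2)" and ?O = "qpoch_inf q (q\<^sup>2)"
  let ?E = "qpoch_inf (- (q\<^sup>2)) (q\<^sup>2)" and ?D = "qpoch_inf (- q) (q\<^sup>2)"
  have q: "fps_X dvd q" "fps_X dvd q\<^sup>2" "fps_X dvd q ^ 4"
    by (simp_all add: q_def dvd_power)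
  \<comment> \<open>Multiplied by \<open>?O\<close>, the run series become
    \<open>q ^ k^2 * ?E\<close>, so their sum is the theta series times \<open>?E\<close>.\<close>
  have G: "?G * ?O = ?D ^ 2 * ?P * ?E"
  proof (rule fps_eq_if_cong)
    fix n
    have "fps_cong n (?G * ?O) ((odd_run_series 0 + 2 * (\<Sum>k = 1..n. odd_run_series k)) * ?O)"
      by (intro fps_cong_mult fps_cong_refl fps_cong_mono[OF fps_cong_sigma_ed_moex]) simp
    also have "\<dots> = odd_run_series 0 * ?O + 2 * (\<Sum>k = 1..n. odd_run_series k * ?O)"
      by (simp add: distrib_right sum_distrib_right mult.assoc)
    also have "\<dots> = (1 + 2 * (\<Sum>k = 1..n. q ^ k\<^sup>2)) * ?E"
      unfolding q_def odd_run_series_eq by (simp add: distrib_right sum_distrib_right mult.assoc)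
    also have "fps_cong n \<dots> (?D ^ 2 * ?P * ?E)"
      unfolding q_def by (intro fps_cong_mult fps_cong_theta fps_cong_refl)
    finally show "fps_cong n (?G * ?O) (?D ^ 2 * ?P * ?E)" .
  qed
  have Q: "qpoch_inf (- q) q = ?D * ?E"
    using qpoch_inf_even_odd[OF q(1), of "- q"] by (simp add: power2_eq_square)
  have euler: "?D * ?E * ?O = 1"
    using euler_distinct_odd[OF q(1)] by (simp add: Q)
  have four: "qpoch_inf (q ^ 4) (q ^ 4) = ?P * ?E"
    using qpoch_inf_mult_uminus[OF q(2), of "q\<^sup>2"] by simp
  \<comment> \<open>By Euler's identity \<open>?D * ?E\<close> is the inverse of \<open>?O\<close>,
    which turns \<open>G\<close> into a formula for \<open>?G\<close> itself.\<close>
  have "?G = ?G * (?D * ?E * ?O)"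
    by (simp add: euler)
  also have "\<dots> = ?D ^ 3 * ?P * ?E ^ 2"
    using G by (simp add: power2_eq_square power3_eq_cube mult_ac)
  finally have "?G * (?P * ?E) = (?D ^ 3 * ?P * ?E ^ 2) * (?P * ?E)"
    by simp
  then show "?G * qpoch_inf (q ^ 4) (q ^ 4) = ?P ^ 2 * qpoch_inf (- q) q ^ 3"
    unfolding four Q by (simp add: power2_eq_square power3_eq_cube mult_ac)
  show "qpoch_inf (q ^ 4) (q ^ 4) $ 0 \<noteq> 0"
    using qpoch_inf_nth_0[OF q(3), of "q ^ 4"] by (simp add: q_def)
qed

lemma sigma_ed_meex_series:
  fixes q :: "'a::field_char_0 fps"
  defines "q \<equiv> fps_X"
  shows "Abs_fps (\<lambda>n. of_nat (sigma_ed_meex n)) =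
    2 * (qpoch_inf (- (q\<^sup>2)) (q\<^sup>2) / qpoch_inf q (q\<^sup>2)) * sigma_series (q\<^sup>2)"
proof -
  let ?G = "Abs_fps (\<lambda>n. of_nat (sigma_ed_meex n)) :: 'a fps"
  let ?O = "qpoch_inf q (q\<^sup>2)" and ?E = "qpoch_inf (- (q\<^sup>2)) (q\<^sup>2)"
  let ?s = "\<lambda>k. (q\<^sup>2) ^ (k * (k + 1) div 2) / qpoch (- (q\<^sup>2)) (q\<^sup>2) k"
  have q: "fps_X dvd q\<^sup>2"
    by (simp add: q_def dvd_power)
  have O0: "?O $ 0 \<noteq> 0" and E0: "?E $ 0 \<noteq> 0"
    using qpoch_inf_nth_0[OF q] by (simp_all add: q_def)
  \<comment> \<open>Up to the common factor \<open>?E\<close>, the run series times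
    \<open>?O\<close> are the summands of \<open>sigma_series\<close> at \<open>q^2\<close>.\<close>
  have run: "even_run_series k * ?O = ?E * ?s k" for k
  proof -
    have u: "qpoch (- (q\<^sup>2)) (q\<^sup>2) k $ 0 \<noteq> 0"
      by (simp add: qpoch_nth_0 q_def)
    have "(q\<^sup>2) ^ (k * (k + 1) div 2) = q ^ (k * (k + 1))"
      by (simp flip: power_mult)
    then have "even_run_series k * ?O = ?E * (q\<^sup>2) ^ (k * (k + 1) div 2) / qpoch (- (q\<^sup>2)) (q\<^sup>2) k"
      using even_run_series_eq[of k, where 'a = 'a]
      by (intro fps_divide_eqI u) (simp add: q_def mult_ac)
    then show ?thesis
      using u by (simp add: fps_divide_unit mult.assoc)
  qed
  \<comment> \<open>The value that the second formula forces on \<open>sigma_series (q^2)\<close>.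
    Showing that the partial sums tend to it gives convergence and the value together;
    characteristic 0 makes \<open>2 * ?E\<close> a unit.\<close>
  define S where "S = ?G * ?O * inverse (2 * ?E)"
  have u: "(2 * ?E) $ 0 \<noteq> 0"
    using E0 by (simp add: numeral_fps_const)
  have S: "2 * ?E * S = ?G * ?O"
    using inverse_mult_eq_1'[OF u] by (simp add: S_def mult_ac)
  have "fps_cong n (\<Sum>k<n. ?s k) S" for n
  proof (rule fps_cong_unit_cancel[OF _ u])
    have "2 * ?E * (\<Sum>k<n. ?s k) = 2 * (\<Sum>k<n. even_run_series k) * ?O"
      by (simp add: sum_distrib_left sum_distrib_right mult.assoc run)
    also have "fps_cong n \<dots> (?G * ?O)"
      by (intro fps_cong_mult fps_cong_refl fps_cong_sym[OF fps_cong_sigma_ed_meex])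
    finally show "fps_cong n (2 * ?E * (\<Sum>k<n. ?s k)) (2 * ?E * S)"
      by (simp only: S)
  qed
  then have "?s sums S"
    unfolding sums_def by (rule fps_LIMSEQ_if_cong)
  then have "sigma_series (q\<^sup>2) = S"
    unfolding sigma_series_def by (rule sums_unique[symmetric])
  moreover have "?G = 2 * ?E * S / ?O"
    using O0 by (intro fps_divide_eqI) (simp_all add: S)
  ultimately show ?thesis
    using O0 by (simp add: fps_divide_unit mult_ac)
qed

theorem theorem1p12:
  fixes q :: "rat fps"
  defines "q \<equiv> fps_X"
  shows "Abs_fps (\<lambda>n. of_nat (sigma_ed_moex n)) =
           qpoch_inf (q\<^sup>2) (q\<^sup>2) ^ 2 * qpoch_inf (- q) q ^ 3 / qpoch_inf (q ^ 4) (q ^ 4) \<and>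
         Abs_fps (\<lambda>n. of_nat (sigma_ed_meex n)) =
           2 * (qpoch_inf (- (q\<^sup>2)) (q\<^sup>2) / qpoch_inf q (q\<^sup>2)) * sigma_series (q\<^sup>2)"
  unfolding q_def by (intro conjI sigma_ed_moex_series sigma_ed_meex_series)

end
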